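(* Let $N\in\mathbb{N}$ and $\widetilde{L}>0$. Let $f:\mathbb{R}^d\to\mathbb{R}$ be a $1$-weakly convex function with $\widetilde{L}$-bounded subgradients, and suppose $f$ has a global minimizer $x_\star$. Let $R>0$, put $\kappa=R/\widetilde{L}$, and let $x_0\in\mathbb{R}^d$ satisfy $$f(y_0)-f(x_\star)+\|x_0-y_0\|^2\le R^2,\qquad\text{where } y_0=\mathbf{prox}_{(1/2)f}(x_0).$$ Consider the iterates $$x_{k+1}=x_k-h f'(x_k),\qquad k=0,1,\dots,N,$$ where $f'(x_k)\in\partial f(x_k)$ is an arbitrary subgradient of $f$ at $x_k$. Then the choice of stepsize $$h=\frac{\sqrt{4\kappa^2(N+1)+1}}{2(N+1)}$$ yields the rate $$\frac{1}{N+1}\sum_{i=0}^{N}\|\nabla f_{(1/2)}(x_i)\|^2\le\frac{\widetilde{L}^2\left(2\sqrt{4\kappa^2(N+1)+1}-1\right)}{N+1}.$$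
   Context: $\mathbb{R}^d$ carries the standard inner product and Euclidean norm $\|\cdot\|$. A function $f:\mathbb{R}^d\to\mathbb{R}$ is $1$-weakly convex if $f+\frac12\|\cdot\|^2$ is convex. The subdifferential $\partial f$ is an abstract subdifferential: it equals the usual convex subdifferential when $f$ is convex, equals $\{\nabla f(x)\}$ at points $x$ where $f$ is continuously differentiable, contains $0$ at local minimizers, and satisfies $\partial\left(f(\cdot)+\frac{\beta}{2}\|\cdot-y\|^2\right)=\partial f(\cdot)+\beta(\cdot-y)$ for all $y\in\mathbb{R}^d$, $\beta\in\mathbb{R}$. In particular, for $1$-weakly convex $f$, $g\in\partial f(x)$ if and only if $f(z)\ge f(x)+\langle g\mid z-x\rangle-\frac12\|z-x\|^2$ for all $z\in\mathbb{R}^d$. The function $f$ has $\widetilde{L}$-bounded subgradients if $\|g\|\le\widetilde{L}$ for all $x\in\mathbb{R}^d$ and $g\in\partial f(x)$. For $1$-weakly convex $f$, the proximal operator and Moreau envelope (with parameter $\hat\rho=2$) are $$\mathbf{prox}_{(1/2)f}(x)=\mathrm{argmin}_{y\in\mathbb{R}^d}\left\{f(y)+\|y-x\|^2\right\},\qquad f_{(1/2)}(x)=\min_{y\in\mathbb{R}^d}\left\{f(y)+\|y-x\|^2\right\}.$$ The minimizer exists and is unique, $f_{(1/2)}$ is continuously differentiable, and with $y=\mathbf{prox}_{(1/2)f}(x)$ one has $\nabla f_{(1/2)}(x)=2(x-y)\in\partial f(y)$. *)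

theory Defs
  imports "HOL-Analysis.Analysis"
begin

definition convex_subdifferential :: "('a::real_inner \<Rightarrow> real) \<Rightarrow> 'a \<Rightarrow> 'a set" where
  "convex_subdifferential f x = {g. \<forall>z. f z \<ge> f x + g \<bullet> (z - x)}"

definition weakly_convex :: "real \<Rightarrow> ('a::real_inner \<Rightarrow> real) \<Rightarrow> bool" where
  "weakly_convex \<rho> f \<longleftrightarrow> convex_on UNIV (\<lambda>x. f x + \<rho> / 2 * (norm x)\<^sup>2)"

text \<open>
  A subdifferential is any operator with the four properties below. It is deliberately not
  fixed to a particular construction: the Clarke subdifferential (on locally Lipschitz
  functions) and the Frechet subdifferential behave this way. In the second property,
  continuous differentiability at a point means that a gradient exists and is continuous on
  some open neighbourhood of the point.
\<close>

locale abstract_subdifferential =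
  fixes D :: "('a::euclidean_space \<Rightarrow> real) \<Rightarrow> 'a \<Rightarrow> 'a set"
  assumes convex_case:
      "\<And>f x. convex_on UNIV f \<Longrightarrow> D f x = convex_subdifferential f x"
    and smooth_case:
      "\<And>f G U x. \<lbrakk>open U; x \<in> U; \<And>z. z \<in> U \<Longrightarrow> GDERIV f z :> G z; continuous_on U G\<rbrakk>
        \<Longrightarrow> D f x = {G x}"
    and local_minimizer:
      "\<And>f x. eventually (\<lambda>z. f x \<le> f z) (nhds x) \<Longrightarrow> 0 \<in> D f x"
    and add_quadratic:
      "\<And>f x y \<beta>. D (\<lambda>z. f z + \<beta> / 2 * (norm (z - y))\<^sup>2) x
        = (\<lambda>g. g + \<beta> *\<^sub>R (x - y)) ` D f x"

definition bounded_subgradients ::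
    "(('a::real_inner \<Rightarrow> real) \<Rightarrow> 'a \<Rightarrow> 'a set) \<Rightarrow> real \<Rightarrow> ('a \<Rightarrow> real) \<Rightarrow> bool" where
  "bounded_subgradients D L f \<longleftrightarrow> (\<forall>x. \<forall>g\<in>D f x. norm g \<le> L)"

text \<open>
  Proximal operator and Moreau envelope of \<open>f\<close> with parameter \<open>1/2\<close>; the penalty
  \<open>(2/2) * (norm (y - x))\<^sup>2\<close> therefore has coefficient one. If \<open>f\<close> is 1-weakly convex, then the
  minimizer selected by \<open>prox_half\<close> is unique and the infimum in \<open>moreau_half\<close> is attained.
\<close>

definition prox_half :: "('a::real_inner \<Rightarrow> real) \<Rightarrow> 'a \<Rightarrow> 'a" where
  "prox_half f x = (ARG_MIN (\<lambda>y. f y + (norm (y - x))\<^sup>2) y. True)"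

definition moreau_half :: "('a::real_inner \<Rightarrow> real) \<Rightarrow> 'a \<Rightarrow> real" where
  "moreau_half f x = (INF y. f y + (norm (y - x))\<^sup>2)"

definition gradient :: "('a::real_inner \<Rightarrow> real) \<Rightarrow> 'a \<Rightarrow> 'a" where
  "gradient f x = (THE G. GDERIV f x :> G)"

end

theory Submission
  imports Defs
begin

text \<open>
  Write \<open>d\<^sub>k = \<parallel>x\<^sub>k - y\<^sub>k\<parallel>\<close> with \<open>y\<^sub>k\<close> the proximal point of \<open>x\<^sub>k\<close>, so that the gradient of the
  envelope at \<open>x\<^sub>k\<close> has norm \<open>2 d\<^sub>k \<le> L\<close>. The envelope gap \<open>E\<^sub>k\<close> satisfies
  \<open>E\<^sub>k\<^sub>+\<^sub>1 \<le> E\<^sub>k - 2 h d\<^sub>k\<^sup>2 + h\<^sup>2 L\<^sup>2\<close>. Telescoping and using only \<open>E \<ge> 0\<close> at the end loses the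
  sharp constant. Using \<open>E\<^sub>k \<ge> d\<^sub>k\<^sup>2\<close> at every step instead, the partial sums
  \<open>A\<^sub>k = d\<^sub>0\<^sup>2 + \<dots> + d\<^sub>k\<^sub>-\<^sub>1\<^sup>2\<close> satisfy \<open>A\<^sub>k\<^sub>+\<^sub>1 \<le> (1 - 2 h) A\<^sub>k + R\<^sup>2 + k h\<^sup>2 L\<^sup>2\<close>, and for \<open>2 h \<le> 1\<close> this
  yields the claim by induction. For \<open>2 h > 1\<close> the claim already follows from \<open>d\<^sub>k \<le> L / 2\<close>.
\<close>

section \<open>Subgradients of weakly convex functions\<close>

text \<open>Adding \<open>\<rho> / 2 * (norm z)\<^sup>2\<close> makes \<open>f\<close> convex and
  shifts each subgradient at \<open>x\<close> by \<open>\<rho> *\<^sub>R x\<close>. In the convex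
  subgradient inequality of the sum, the quadratic terms combine to
  \<open>\<rho> / 2 * (norm (z - x))\<^sup>2\<close>.\<close>

lemma (in abstract_subdifferential) weakly_convex_subdifferential:
  assumes "weakly_convex \<rho> f"
  shows "g \<in> D f x \<longleftrightarrow> (\<forall>z. f z \<ge> f x + g \<bullet> (z - x) - \<rho> / 2 * (norm (z - x))\<^sup>2)"
proof -
  let ?h = "\<lambda>z. f z + \<rho> / 2 * (norm (z - 0))\<^sup>2"
  have "g \<in> D f x \<longleftrightarrow> g + \<rho> *\<^sub>R x \<in> D ?h x"
    unfolding add_quadratic by auto
  also have "D ?h x = convex_subdifferential ?h x"
    using assms by (intro convex_case) (simp add: weakly_convex_def)
  also have "g + \<rho> *\<^sub>R x \<in> convex_subdifferential ?h x \<longleftrightarrow>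
      (\<forall>z. f z \<ge> f x + g \<bullet> (z - x) - \<rho> / 2 * (norm (z - x))\<^sup>2)"
  proof -
    have "?h z - (?h x + (g + \<rho> *\<^sub>R x) \<bullet> (z - x)) =
        f z - (f x + g \<bullet> (z - x) - \<rho> / 2 * (norm (z - x))\<^sup>2)" for z
    proof -
      define c where "c = \<rho> / 2"
      then have "\<rho> = 2 * c" by simp
      then show ?thesis
        by (simp add: power2_norm_eq_inner algebra_simps inner_commute)
    qed
    then have "(?h z \<ge> ?h x + (g + \<rho> *\<^sub>R x) \<bullet> (z - x)) \<longleftrightarrow>
        (f z \<ge> f x + g \<bullet> (z - x) - \<rho> / 2 * (norm (z - x))\<^sup>2)" for z
      by (smt (verit))
    then show ?thesis
      unfolding convex_subdifferential_def by blast
  qed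
  finally show ?thesis .
qed

lemma weakly_convex_continuous:
  fixes f :: "'a::euclidean_space \<Rightarrow> real"
  assumes "weakly_convex \<rho> f"
  shows "continuous_on UNIV f"
proof -
  have "continuous_on UNIV (\<lambda>x. f x + \<rho> / 2 * (norm x)\<^sup>2)"
    using assms convex_on_continuous[OF open_UNIV] unfolding weakly_convex_def by blast
  then have "continuous_on UNIV (\<lambda>x. (f x + \<rho> / 2 * (norm x)\<^sup>2) - \<rho> / 2 * (norm x)\<^sup>2)"
    by (rule continuous_on_diff) (intro continuous_intros)
  then show ?thesis by simp
qed

section \<open>Proximal points and the envelope\<close>

text \<open>Since \<open>prox_half\<close> is defined by choice, an attained minimum has to be
  exhibited first. Outside the ball of radius \<open>r\<close> the penalty alone is at least
  \<open>f x - m\<close>, so no value there is below \<open>f x\<close>, the value at the centre. On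
  the ball, compactness gives a minimum.\<close>

lemma prox_half_minimizes:
  fixes f :: "'a::euclidean_space \<Rightarrow> real"
  assumes cont: "continuous_on UNIV f" and bound: "\<And>z. m \<le> f z"
  shows "f (prox_half f x) + (norm (prox_half f x - x))\<^sup>2 \<le> f z + (norm (z - x))\<^sup>2"
proof -
  let ?\<phi> = "\<lambda>y. f y + (norm (y - x))\<^sup>2"
  define r where "r = sqrt (f x - m)"
  have r: "r \<ge> 0" "r\<^sup>2 = f x - m"
    using bound[of x] by (simp_all add: r_def)
  have "continuous_on (cball x r) ?\<phi>"
    by (intro continuous_intros continuous_on_subset[OF cont]) auto
  then obtain y where "\<forall>w\<in>cball x r. ?\<phi> y \<le> ?\<phi> w"
    using continuous_attains_inf[of "cball x r" ?\<phi>] r(1) by auto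
  then have y: "?\<phi> y \<le> ?\<phi> w" if "w \<in> cball x r" for w
    using that by blast
  have "?\<phi> y \<le> ?\<phi> w" for w
  proof (cases "w \<in> cball x r")
    case False
    then have "r\<^sup>2 \<le> (norm (w - x))\<^sup>2"
      using r(1) by (intro power_mono) (auto simp: dist_norm norm_minus_commute)
    then show ?thesis
      using y[of x] r bound[of w] by simp
  qed (rule y)
  then have "is_arg_min ?\<phi> (\<lambda>_. True) y"
    by (auto simp: is_arg_min_def not_less)
  then have "is_arg_min ?\<phi> (\<lambda>_. True) (prox_half f x)"
    unfolding prox_half_def arg_min_def by (rule someI)
  then show ?thesis
    by (auto simp: is_arg_min_def not_less)
qed

lemma moreau_half_eq_prox_half:
  fixes f :: "'a::euclidean_space \<Rightarrow> real"
  assumes "continuous_on UNIV f" and "\<And>z. m \<le> f z"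
  shows "moreau_half f x = f (prox_half f x) + (norm (prox_half f x - x))\<^sup>2"
  unfolding moreau_half_def
proof (rule cInf_eq_minimum)
  fix v assume "v \<in> range (\<lambda>y. f y + (norm (y - x))\<^sup>2)"
  then show "f (prox_half f x) + (norm (prox_half f x - x))\<^sup>2 \<le> v"
    using prox_half_minimizes[OF assms] by blast
qed simp

lemma moreau_half_le:
  fixes f :: "'a::euclidean_space \<Rightarrow> real"
  assumes "continuous_on UNIV f" and "\<And>z. m \<le> f z"
  shows "moreau_half f x \<le> f z + (norm (z - x))\<^sup>2"
  unfolding moreau_half_eq_prox_half[OF assms] by (rule prox_half_minimizes[OF assms])

lemma (in abstract_subdifferential) prox_half_subgradient:
  assumes "continuous_on UNIV f" and "\<And>z. m \<le> f z"
  shows "2 *\<^sub>R (x - prox_half f x) \<in> D f (prox_half f x)"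
proof -
  let ?y = "prox_half f x"
  \<comment> \<open>Fermat's rule at the proximal point; the coefficient is written
    \<open>2 / 2\<close> so that \<open>add_quadratic\<close> applies with
    \<open>\<beta> = 2\<close>.\<close>
  have "0 \<in> D (\<lambda>z. f z + 2 / 2 * (norm (z - x))\<^sup>2) ?y"
    using prox_half_minimizes[OF assms] by (intro local_minimizer always_eventually) auto
  then obtain g where "g \<in> D f ?y" "0 = g + 2 *\<^sub>R (?y - x)"
    unfolding add_quadratic by auto
  moreover from this(2) have "g = 2 *\<^sub>R (x - ?y)"
    by (simp add: eq_neg_iff_add_eq_0 algebra_simps)
  ultimately show ?thesis by simp
qed

text \<open>The subgradient inequalities at the two proximal points, each tested at the other point,
  are added. The values of \<open>f\<close> cancel, and the penalty contributes twice the squared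
  norm of \<open>?d\<close> while weak convexity costs it once.\<close>

lemma (in abstract_subdifferential) prox_half_lipschitz:
  fixes f :: "'a \<Rightarrow> real"
  assumes wc: "weakly_convex 1 f" and bound: "\<And>z. m \<le> f z"
  shows "norm (prox_half f z - prox_half f x) \<le> 2 * norm (z - x)"
proof -
  note cont = weakly_convex_continuous[OF wc]
  let ?d = "prox_half f z - prox_half f x"
  have "f (prox_half f z) \<ge> f (prox_half f x) + (2 *\<^sub>R (x - prox_half f x)) \<bullet> ?d
      - 1 / 2 * (norm ?d)\<^sup>2"
    using weakly_convex_subdifferential[OF wc, THEN iffD1, OF prox_half_subgradient[OF cont bound]]
    by (rule spec)
  moreover have "f (prox_half f x) \<ge> f (prox_half f z) + (2 *\<^sub>R (z - prox_half f z)) \<bullet> (- ?d)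
      - 1 / 2 * (norm (- ?d))\<^sup>2"
    using spec[OF weakly_convex_subdifferential[OF wc, THEN iffD1, OF prox_half_subgradient[OF cont bound]],
        of z "prox_half f x"]
    by simp
  ultimately have "(norm ?d)\<^sup>2 \<le> 2 * ((z - x) \<bullet> ?d)"
    by (simp add: power2_norm_eq_inner algebra_simps inner_commute)
  also have "\<dots> \<le> 2 * (norm (z - x) * norm ?d)"
    by (simp add: norm_cauchy_schwarz)
  finally have "norm ?d * norm ?d \<le> (2 * norm (z - x)) * norm ?d"
    by (simp add: power2_eq_square)
  then show ?thesis
    by (cases "norm ?d = 0") (auto simp: mult_le_cancel_right)
qed

section \<open>Gradient of the envelope\<close>

lemma GDERIV_quadratic_bound:
  fixes F :: "'a::real_inner \<Rightarrow> real"
  assumes "\<And>z. \<bar>F z - F x - G \<bullet> (z - x)\<bar> \<le> C * (norm (z - x))\<^sup>2"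
  shows "GDERIV F x :> G"
  unfolding gderiv_def has_derivative_iff_norm
proof (intro conjI)
  show "bounded_linear (\<lambda>h. h \<bullet> G)"
    by (rule bounded_linear_inner_left)
  have "((\<lambda>z. C * norm (z - x)) \<longlongrightarrow> C * norm (x - x)) (at x)"
    by (intro tendsto_intros)
  then have "((\<lambda>z. C * norm (z - x)) \<longlongrightarrow> 0) (at x)"
    by simp
  moreover have "norm (F z - F x - (z - x) \<bullet> G) / norm (z - x) \<le> C * norm (z - x)" for z
    using assms[of z] by (cases "z = x") (simp_all add: inner_commute divide_simps power2_eq_square)
  ultimately show "((\<lambda>z. norm (F z - F x - (z - x) \<bullet> G) / norm (z - x)) \<longlongrightarrow> 0) (at x)"
    by (rule_tac Lim_null_comparison) auto
qed

lemma gradient_eqI: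
  assumes "GDERIV F x :> G"
  shows "gradient F x = G"
  unfolding gradient_def
proof (rule the_equality)
  show "GDERIV F x :> G" by fact
next
  fix G' assume "GDERIV F x :> G'"
  then have "(\<lambda>h. h \<bullet> G') = (\<lambda>h. h \<bullet> G)"
    using assms unfolding gderiv_def by (rule has_derivative_unique)
  then have "\<forall>h. h \<bullet> G' = h \<bullet> G"
    by (simp add: fun_eq_iff)
  then show "G' = G"
    by (simp only: vector_eq_ldot)
qed

text \<open>The proximal point of \<open>x\<close> is a competitor in the envelope at
  \<open>z\<close>, and conversely. The first bounds the linearization error from above, the second
  from below, up to a cross term controlled by the Lipschitz bound.\<close>

lemma (in abstract_subdifferential) gradient_moreau_half:
  fixes f :: "'a \<Rightarrow> real"
  assumes wc: "weakly_convex 1 f" and bound: "\<And>z. m \<le> f z"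
  shows "gradient (moreau_half f) x = 2 *\<^sub>R (x - prox_half f x)"
proof (intro gradient_eqI GDERIV_quadratic_bound[where C = 3])
  fix z
  note cont = weakly_convex_continuous[OF wc]
  note env = moreau_half_eq_prox_half[OF cont bound]
  let ?y = "prox_half f x" and ?w = "prox_half f z"
  have "moreau_half f z \<le> f ?y + (norm (?y - z))\<^sup>2"
    by (rule moreau_half_le[OF cont bound])
  then have upper: "moreau_half f z - moreau_half f x - (2 *\<^sub>R (x - ?y)) \<bullet> (z - x) \<le> (norm (z - x))\<^sup>2"
    unfolding env[of x] by (simp add: power2_norm_eq_inner algebra_simps inner_commute)
  have "moreau_half f x \<le> f ?w + (norm (?w - x))\<^sup>2"
    by (rule moreau_half_le[OF cont bound])
  then have lower: "moreau_half f z - moreau_half f x - (2 *\<^sub>R (x - ?y)) \<bullet> (z - x)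
      \<ge> (norm (z - x))\<^sup>2 - 2 * ((?w - ?y) \<bullet> (z - x))"
    unfolding env[of z] by (simp add: power2_norm_eq_inner algebra_simps inner_commute)
  \<comment> \<open>The lower bound becomes \<open>1 - 2 * 2\<close> times the squared distance,
    whence \<open>C = 3\<close>.\<close>
  have "(?w - ?y) \<bullet> (z - x) \<le> norm (?w - ?y) * norm (z - x)"
    by (rule norm_cauchy_schwarz)
  also have "\<dots> \<le> (2 * norm (z - x)) * norm (z - x)"
    by (intro mult_right_mono prox_half_lipschitz[OF wc bound]) simp
  finally have "(?w - ?y) \<bullet> (z - x) \<le> 2 * (norm (z - x))\<^sup>2"
    by (simp add: power2_eq_square)
  moreover have "0 \<le> (norm (z - x))\<^sup>2" by simp
  ultimately show "\<bar>moreau_half f z - moreau_half f x - (2 *\<^sub>R (x - ?y)) \<bullet> (z - x)\<bar>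
      \<le> 3 * (norm (z - x))\<^sup>2"
    using upper lower by linarith
qed

section \<open>Descent of the envelope and summation\<close>

text \<open>The old proximal point serves as competitor at the new iterate. Expanding the square
  leaves a cross term, which is bounded by adding the subgradient inequalities at \<open>x\<close>
  and at \<open>?y\<close>: the coefficients are \<open>2 - 1/2 - 1/2 = 1\<close>.\<close>

lemma (in abstract_subdifferential) moreau_half_subgradient_step:
  assumes wc: "weakly_convex 1 f" and bound: "\<And>z. m \<le> f z"
    and g: "g \<in> D f x" and "h \<ge> 0"
  shows "moreau_half f (x - h *\<^sub>R g)
    \<le> moreau_half f x - 2 * h * (norm (x - prox_half f x))\<^sup>2 + h\<^sup>2 * (norm g)\<^sup>2"
proof -
  note cont = weakly_convex_continuous[OF wc]
  let ?y = "prox_half f x"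
  have "f ?y \<ge> f x + g \<bullet> (?y - x) - 1 / 2 * (norm (?y - x))\<^sup>2"
    using weakly_convex_subdifferential[OF wc, THEN iffD1, OF g] by (rule spec)
  moreover have "f x \<ge> f ?y + (2 *\<^sub>R (x - ?y)) \<bullet> (x - ?y) - 1 / 2 * (norm (x - ?y))\<^sup>2"
    using weakly_convex_subdifferential[OF wc, THEN iffD1, OF prox_half_subgradient[OF cont bound]]
    by (rule spec)
  moreover have "(2 *\<^sub>R (x - ?y)) \<bullet> (x - ?y) = 2 * (norm (x - ?y))\<^sup>2"
    by (simp add: power2_norm_eq_inner)
  moreover have "g \<bullet> (?y - x) = - (g \<bullet> (x - ?y))"
    by (simp add: inner_diff_right)
  moreover have "(norm (?y - x))\<^sup>2 = (norm (x - ?y))\<^sup>2"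
    by (simp add: norm_minus_commute)
  ultimately have "(norm (x - ?y))\<^sup>2 \<le> g \<bullet> (x - ?y)"
    by linarith
  then have "2 * h * (norm (x - ?y))\<^sup>2 \<le> 2 * h * (g \<bullet> (x - ?y))"
    using \<open>h \<ge> 0\<close> by (simp add: mult_left_mono)
  moreover have "(norm (?y - (x - h *\<^sub>R g)))\<^sup>2
      = (norm (?y - x))\<^sup>2 - 2 * h * (g \<bullet> (x - ?y)) + h\<^sup>2 * (norm g)\<^sup>2"
  proof -
    have "norm (?y - (x - h *\<^sub>R g)) = norm (h *\<^sub>R g - (x - ?y))"
      by (rule arg_cong[of _ _ norm]) simp
    moreover have "(norm (h *\<^sub>R g - (x - ?y)))\<^sup>2
        = (norm (h *\<^sub>R g))\<^sup>2 + (norm (x - ?y))\<^sup>2 - 2 * ((h *\<^sub>R g) \<bullet> (x - ?y))"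
      unfolding power2_norm_eq_inner inner_diff by (simp add: inner_commute)
    ultimately show ?thesis
      by (simp add: power_mult_distrib norm_minus_commute)
  qed
  moreover have "moreau_half f (x - h *\<^sub>R g) \<le> f ?y + (norm (?y - (x - h *\<^sub>R g)))\<^sup>2"
    by (rule moreau_half_le[OF cont bound])
  ultimately show ?thesis
    unfolding moreau_half_eq_prox_half[OF cont bound, of x] by linarith
qed

text \<open>Here \<open>q\<close> is the error per step, and \<open>M\<close> the excess of the sum
  over \<open>n * q\<close>. Bounding the newest term by the telescoped \<open>E k\<close> gives the
  old sum the factor \<open>1 - 2 * h\<close>, which is nonnegative, so the induction hypothesis can
  be inserted.\<close>

lemma sum_bound_from_descent:
  fixes a E :: "nat \<Rightarrow> real"
  assumes h: "2 * h \<le> 1"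
    and a: "\<And>k. k < n \<Longrightarrow> a k \<le> E k"
    and step: "\<And>k. k < n \<Longrightarrow> E (Suc k) \<le> E k - 2 * h * (a k - q)"
    and M: "0 \<le> M" "E 0 - q \<le> 2 * h * M"
  shows "(\<Sum>i<n. a i) \<le> real n * q + M"
proof -
  have E: "E k \<le> E 0 - 2 * h * ((\<Sum>i<k. a i) - real k * q)" if "k \<le> n" for k
    using that
  proof (induction k)
    case (Suc k)
    have "E (Suc k) \<le> E 0 - 2 * h * ((\<Sum>i<k. a i) - real k * q) - 2 * h * (a k - q)"
      using Suc step[of k] by simp
    also have "\<dots> = E 0 - 2 * h * ((\<Sum>i<Suc k. a i) - real (Suc k) * q)"
      by (simp add: algebra_simps)
    finally show ?case .
  qed simp
  have "(\<Sum>i<k. a i) \<le> real k * q + M" if "k \<le> n" for k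
    using that
  proof (induction k)
    case (Suc k)
    have "a k \<le> E 0 - 2 * h * ((\<Sum>i<k. a i) - real k * q)"
      using E[of k] a[of k] Suc.prems by linarith
    then have "(\<Sum>i<Suc k. a i) \<le> (1 - 2 * h) * (\<Sum>i<k. a i) + E 0 + 2 * h * (real k * q)"
      by (simp add: algebra_simps)
    also have "\<dots> \<le> (1 - 2 * h) * (real k * q + M) + E 0 + 2 * h * (real k * q)"
      using h Suc.IH Suc.prems by (intro add_right_mono mult_left_mono) auto
    also have "\<dots> = real k * q + M + (E 0 - 2 * h * M)"
      by (simp add: algebra_simps)
    \<comment> \<open>The condition on \<open>M\<close> says that \<open>E 0 - 2 * h * M\<close> is
      at most one further \<open>q\<close>, so the excess does not grow.\<close>
    also have "\<dots> \<le> real (Suc k) * q + M"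
      using M(2) by (simp add: algebra_simps)
    finally show ?case .
  qed (use M in simp)
  then show ?thesis by simp
qed

section \<open>The rate for the prescribed step size\<close>

theorem corollary1:
  fixes D :: "('a::euclidean_space \<Rightarrow> real) \<Rightarrow> 'a \<Rightarrow> 'a set"
    and f :: "'a \<Rightarrow> real"
    and x g :: "nat \<Rightarrow> 'a"
    and xstar y0 :: 'a
    and N :: nat
    and L R \<kappa> h :: real
  assumes "abstract_subdifferential D"
    and "L > 0"
    and "weakly_convex 1 f"
    and "bounded_subgradients D L f"
    and "\<And>z. f xstar \<le> f z"
    and "R > 0"
    and "\<kappa> = R / L"
    and "y0 = prox_half f (x 0)"
    and "f y0 - f xstar + (norm (x 0 - y0))\<^sup>2 \<le> R\<^sup>2"
    and "h = sqrt (4 * \<kappa>\<^sup>2 * (real N + 1) + 1) / (2 * (real N + 1))"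
    and "\<And>k. k \<le> N \<Longrightarrow> g k \<in> D f (x k)"
    and "\<And>k. k \<le> N \<Longrightarrow> x (Suc k) = x k - h *\<^sub>R g k"
  shows "1 / (real N + 1) * (\<Sum>i=0..N. (norm (gradient (moreau_half f) (x i)))\<^sup>2)
    \<le> L\<^sup>2 * (2 * sqrt (4 * \<kappa>\<^sup>2 * (real N + 1) + 1) - 1) / (real N + 1)"
proof -
  interpret abstract_subdifferential D by fact
  note wc = assms(3) and bound = assms(5)
  note cont = weakly_convex_continuous[OF wc]
  define K where "K = real N + 1"
  define d where "d k = norm (x k - prox_half f (x k))" for k
  define E where "E k = moreau_half f (x k) - f xstar" for k
  have K: "K \<ge> 1" by (simp add: K_def)
  define S where "S = sqrt (4 * \<kappa>\<^sup>2 * K + 1)"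
  have S: "S \<ge> 1" "S\<^sup>2 = 4 * \<kappa>\<^sup>2 * K + 1"
    using K by (simp_all add: S_def)
  have S_h: "S = 2 * K * h"
    using assms(10) K by (simp add: S_def K_def)
  have "0 < K * h" "2 * K * h \<ge> 1"
    using S(1) S_h by auto
  then have h: "h > 0" "2 * K * h \<ge> 1"
    using K by (simp_all add: zero_less_mult_iff)
  \<comment> \<open>the step size is the positive root of this equation\<close>
  have R: "R\<^sup>2 = L\<^sup>2 * (K * h\<^sup>2 - 1 / (4 * K))"
  proof -
    have "4 * \<kappa>\<^sup>2 * K = 4 * K\<^sup>2 * h\<^sup>2 - 1"
      using S(2) unfolding S_h by (simp add: power_mult_distrib)
    then have "\<kappa>\<^sup>2 = K * h\<^sup>2 - 1 / (4 * K)"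
      using K by (simp add: field_simps power2_eq_square)
    moreover have "R = L * \<kappa>"
      using assms(2,7) by simp
    ultimately show ?thesis
      by (simp add: power_mult_distrib)
  qed
  have dL: "(d k)\<^sup>2 \<le> L\<^sup>2 / 4" for k
  proof -
    have "norm (2 *\<^sub>R (x k - prox_half f (x k))) \<le> L"
      using assms(4) prox_half_subgradient[OF cont bound] unfolding bounded_subgradients_def by blast
    then have "(2 * d k)\<^sup>2 \<le> L\<^sup>2"
      by (intro power_mono) (auto simp: d_def)
    then show ?thesis by (simp add: power_mult_distrib)
  qed
  have dE: "(d k)\<^sup>2 \<le> E k" for k
    using bound[of "prox_half f (x k)"]
    by (simp add: E_def d_def moreau_half_eq_prox_half[OF cont bound] norm_minus_commute)
  \<comment> \<open>The error \<open>h\<^sup>2 * L\<^sup>2\<close> is written as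
    \<open>2 * h * q\<close> with \<open>q = h * L\<^sup>2 / 2\<close>.\<close>
  have step: "E (Suc k) \<le> E k - 2 * h * ((d k)\<^sup>2 - h * L\<^sup>2 / 2)" if "k < Suc N" for k
  proof -
    have g: "g k \<in> D f (x k)" "x (Suc k) = x k - h *\<^sub>R g k"
      using that assms(11,12) by auto
    have "norm (g k) \<le> L"
      using g(1) assms(4) unfolding bounded_subgradients_def by blast
    then have "h\<^sup>2 * (norm (g k))\<^sup>2 \<le> h\<^sup>2 * L\<^sup>2"
      by (intro mult_left_mono power_mono) auto
    then have "E (Suc k) \<le> E k - 2 * h * (d k)\<^sup>2 + h\<^sup>2 * L\<^sup>2"
      using moreau_half_subgradient_step[OF wc bound g(1), of h] h(1)
      unfolding E_def d_def g(2) by linarith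
    then show ?thesis
      by (simp add: algebra_simps power2_eq_square)
  qed
  have E0: "E 0 \<le> R\<^sup>2"
    using assms(8,9)
    by (simp add: E_def moreau_half_eq_prox_half[OF cont bound] norm_minus_commute)
  \<comment> \<open>This is a quarter of the target \<open>L\<^sup>2 * (2 * S - 1)\<close>, because
    \<open>S = 2 * K * h\<close>.\<close>
  have "(\<Sum>i<Suc N. (d i)\<^sup>2) \<le> L\<^sup>2 * (K * h - 1 / 4)"
  proof (cases "2 * h \<le> 1")
    case True
    \<comment> \<open>The least nonnegative excess that the summation lemma admits when
      \<open>E 0\<close> is replaced by its bound \<open>R\<^sup>2\<close>.\<close>
    define M where "M = max 0 ((R\<^sup>2 - h * L\<^sup>2 / 2) / (2 * h))"
    have "(\<Sum>i<Suc N. (d i)\<^sup>2) \<le> real (Suc N) * (h * L\<^sup>2 / 2) + M"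
    proof (rule sum_bound_from_descent[where a = "\<lambda>i. (d i)\<^sup>2" and E = E, OF True dE step])
      have "R\<^sup>2 - h * L\<^sup>2 / 2 \<le> M * (2 * h)"
        using h(1) by (simp add: M_def max_def divide_simps split: if_splits)
      then show "E 0 - h * L\<^sup>2 / 2 \<le> 2 * h * M"
        using E0 by (simp add: mult_ac)
    qed (auto simp: M_def)
    also have "\<dots> = L\<^sup>2 * (K * h / 2) + M"
      by (simp add: K_def algebra_simps)
    also have "M \<le> L\<^sup>2 * (K * h / 2 - 1 / 4)"
    proof -
      \<comment> \<open>Dropping the negative term \<open>- 1 / (4 * K)\<close> leaves an expression
        with the factor \<open>2 * h\<close>.\<close>
      have "R\<^sup>2 - h * L\<^sup>2 / 2 \<le> L\<^sup>2 * (K * h\<^sup>2 - h / 2)"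
        unfolding R using K by (simp add: algebra_simps)
      also have "\<dots> = L\<^sup>2 * (K * h / 2 - 1 / 4) * (2 * h)"
        by (simp add: algebra_simps power2_eq_square)
      finally have "(R\<^sup>2 - h * L\<^sup>2 / 2) / (2 * h) \<le> L\<^sup>2 * (K * h / 2 - 1 / 4)"
        using h(1) by (subst pos_divide_le_eq) auto
      moreover have "0 \<le> L\<^sup>2 * (K * h / 2 - 1 / 4)"
        using h(2) by (intro mult_nonneg_nonneg) auto
      ultimately show ?thesis
        by (simp add: M_def)
    qed
    finally show ?thesis by (simp add: algebra_simps)
  next
    case False
    have "(\<Sum>i<Suc N. (d i)\<^sup>2) \<le> (\<Sum>i<Suc N. L\<^sup>2 / 4)"
      by (intro sum_mono dL)
    also have "\<dots> = L\<^sup>2 * (K / 4)"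
      by (simp add: K_def algebra_simps)
    also have "\<dots> \<le> L\<^sup>2 * (K * h - 1 / 4)"
    proof (intro mult_left_mono)
      \<comment> \<open>It suffices that \<open>K / 4 + 1 / 4 \<le> K / 2\<close>, which is
        \<open>K \<ge> 1\<close>.\<close>
      have "K * (1 / 2) \<le> K * h"
        using False K by (intro mult_left_mono) auto
      then show "K / 4 \<le> K * h - 1 / 4"
        using K by linarith
    qed simp
    finally show ?thesis .
  qed
  then have "4 * (\<Sum>i<Suc N. (d i)\<^sup>2) \<le> L\<^sup>2 * (2 * S - 1)"
    unfolding S_h by (simp add: algebra_simps)
  moreover have "(\<Sum>i=0..N. (norm (gradient (moreau_half f) (x i)))\<^sup>2) = 4 * (\<Sum>i<Suc N. (d i)\<^sup>2)"
    by (simp add: gradient_moreau_half[OF wc bound] d_def power_mult_distrib sum_distrib_left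
        atLeast0AtMost lessThan_Suc_atMost)
  ultimately have "(\<Sum>i=0..N. (norm (gradient (moreau_half f) (x i)))\<^sup>2) \<le> L\<^sup>2 * (2 * S - 1)"
    by simp
  then show ?thesis
    by (simp add: S_def K_def divide_right_mono)
qed

end
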